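(* If $\mathcal{H}$ is a $k$-uniform hypergraph with $n$ vertices and $m$ edges, then $\sqrt{km} \le \mathtt{BE}(\mathcal{H}) \le \sqrt{kmn}$. Moreover, the first inequality is an equality if and only if $\mathcal{H}$ has at most one edge, while the second inequality is an equality if and only if $\mathcal{H}$ has no edges.
   Context: A hypergraph $\mathcal{H}=(V,E)$ has a finite vertex set $V$ and an edge set $E\subseteq 2^V$; it is $k$-uniform ($k\ge2$) if every edge has exactly $k$ vertices. Its incidence matrix $\mathbf{B}$ is the $|V|\times|E|$ matrix with $b(v,e)=1$ if $v\in e$ and $0$ otherwise. The incidence energy $\mathtt{BE}(\mathcal{H})$ is the sum of the singular values of $\mathbf{B}$ (i.e. of the square roots of the eigenvalues of $\mathbf{B}\mathbf{B}^T$) if $\mathcal{H}$ has at least one edge, and $0$ otherwise. *)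

theory Defs
  imports Complex_Main "Jordan_Normal_Form.Char_Poly"
begin

definition hypergraph :: "'a set \<Rightarrow> 'a set set \<Rightarrow> bool" where
  "hypergraph V E \<longleftrightarrow> finite V \<and> E \<subseteq> Pow V"

definition uniform_hypergraph :: "nat \<Rightarrow> 'a set \<Rightarrow> 'a set set \<Rightarrow> bool" where
  "uniform_hypergraph k V E \<longleftrightarrow> hypergraph V E \<and> k \<ge> 2 \<and> (\<forall>e\<in>E. card e = k)"

text \<open>Rows and columns are labelled by vertices and edges; a matrix with numerical
  indices therefore needs enumerations of both.\<close>

definition incidence_mat :: "'a list \<Rightarrow> 'a set list \<Rightarrow> real mat" where
  "incidence_mat vs es =
     mat (length vs) (length es) (\<lambda>(i, j). if vs ! i \<in> es ! j then 1 else 0)"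

text \<open>The matrix \<open>A * A\<^sup>T\<close> is real, symmetric and positive semidefinite, so its
  characteristic polynomial splits over the reals and the multiset of real roots consists of
  all eigenvalues with multiplicity.\<close>

definition singular_values :: "real mat \<Rightarrow> real multiset" where
  "singular_values A = image_mset sqrt (proots (char_poly (A * transpose_mat A)))"

definition enumeration :: "'a set \<Rightarrow> 'a list" where
  "enumeration S = (SOME xs. distinct xs \<and> set xs = S)"

text \<open>The choice of enumerations is immaterial, see \<open>incidence_energy_eq\<close> below.\<close>

definition incidence_energy :: "'a set \<Rightarrow> 'a set set \<Rightarrow> real" where
  "incidence_energy V E =
     (if E = {} then 0
      else sum_mset (singular_values (incidence_mat (enumeration V) (enumeration E))))"

lemma enumeration:
  assumes "finite S"
  shows "distinct (enumeration S)" "set (enumeration S) = S"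
proof -
  have "\<exists>xs. distinct xs \<and> set xs = S"
    using finite_distinct_list[OF assms] by blast
  from someI_ex[OF this] show "distinct (enumeration S)" "set (enumeration S) = S"
    unfolding enumeration_def by auto
qed

lemma incidence_mat_mult_transpose:
  assumes "distinct es"
  shows "incidence_mat vs es * transpose_mat (incidence_mat vs es) =
    mat (length vs) (length vs)
      (\<lambda>(i, j). real (card {e \<in> set es. vs ! i \<in> e \<and> vs ! j \<in> e}))"
proof (rule eq_matI, goal_cases)
  case (1 i j)
  let ?f = "\<lambda>e. if vs ! i \<in> e \<and> vs ! j \<in> e then 1 else (0::real)"
  have "(incidence_mat vs es * transpose_mat (incidence_mat vs es)) $$ (i, j) =
      (\<Sum>l = 0..<length es. ?f (es ! l))"
    using 1 by (auto simp: incidence_mat_def scalar_prod_def intro!: sum.cong)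
  also have "\<dots> = (\<Sum>e\<in>set es. ?f e)"
    using sum.reindex_bij_betw[OF bij_betw_nth[OF assms refl refl], of ?f]
    by (simp add: atLeast0LessThan)
  also have "\<dots> = real (card {e \<in> set es. vs ! i \<in> e \<and> vs ! j \<in> e})"
    by (simp flip: sum.inter_filter)
  finally show ?case using 1 by simp
qed (auto simp: incidence_mat_def)

lemma char_poly_mat_permute:
  fixes f :: "'a \<Rightarrow> 'a \<Rightarrow> real"
  assumes "distinct xs" "distinct ys" "set xs = set ys"
  shows "char_poly (mat (length xs) (length xs) (\<lambda>(i, j). f (xs ! i) (xs ! j))) =
    char_poly (mat (length ys) (length ys) (\<lambda>(i, j). f (ys ! i) (ys ! j)))"
proof -
  define n where "n = length xs"
  have lx: "length xs = n" and ly: "length ys = n"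
    using assms by (auto simp: n_def simp flip: distinct_card)
  define D :: "'a list \<Rightarrow> 'a list \<Rightarrow> real mat" where
    "D us vs = mat n n (\<lambda>(i, j). if us ! i = vs ! j then 1 else 0)" for us vs
  have reindex: "(\<Sum>l = 0..<n. g (zs ! l)) = sum g (set zs)"
    if "distinct zs" "length zs = n" for zs and g :: "'a \<Rightarrow> real"
    using sum.reindex_bij_betw[OF bij_betw_nth[OF that(1) refl refl], of g] that(2)
    by (simp add: atLeast0LessThan)
  have DD: "D us vs * D vs us = 1\<^sub>m n"
    if "distinct us" "distinct vs" "set us = set vs" "length us = n" "length vs = n" for us vs
  proof (rule eq_matI, goal_cases)
    case (1 i j)
    have "(D us vs * D vs us) $$ (i, j) =
        (\<Sum>l = 0..<n. (\<lambda>v. if us ! i = v then (if v = us ! j then 1 else 0) else 0) (vs ! l))"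
      using 1 by (auto simp: D_def scalar_prod_def intro!: sum.cong)
    also have "\<dots> = (if us ! i = us ! j then 1 else 0)"
      using 1 that by (subst reindex) (auto simp flip: that(3))
    finally show ?case using 1 that by (simp add: nth_eq_iff_index_eq)
  qed (auto simp: D_def)
  let ?X = "mat n n (\<lambda>(i, j). f (xs ! i) (xs ! j))"
  let ?Y = "mat n n (\<lambda>(i, j). f (ys ! i) (ys ! j))"
  have XD: "D xs ys * ?Y = mat n n (\<lambda>(i, j). f (xs ! i) (ys ! j))"
  proof (rule eq_matI, goal_cases)
    case (1 i j)
    have "(D xs ys * ?Y) $$ (i, j) =
        (\<Sum>l = 0..<n. (\<lambda>v. if xs ! i = v then f v (ys ! j) else 0) (ys ! l))"
      using 1 by (auto simp: D_def scalar_prod_def intro!: sum.cong)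
    also have "\<dots> = f (xs ! i) (ys ! j)"
      using 1 lx ly assms by (subst reindex) (auto simp flip: assms(3))
    finally show ?case using 1 by simp
  qed (auto simp: D_def)
  have "mat n n (\<lambda>(i, j). f (xs ! i) (ys ! j)) * D ys xs = ?X"
  proof (rule eq_matI, goal_cases)
    case (1 i j)
    have "(mat n n (\<lambda>(i, j). f (xs ! i) (ys ! j)) * D ys xs) $$ (i, j) =
        (\<Sum>l = 0..<n. (\<lambda>v. if v = xs ! j then f (xs ! i) v else 0) (ys ! l))"
      using 1 by (auto simp: D_def scalar_prod_def intro!: sum.cong)
    also have "\<dots> = f (xs ! i) (xs ! j)"
      using 1 lx ly assms by (subst reindex) (auto simp flip: assms(3))
    finally show ?case using 1 by simp
  qed (auto simp: D_def)
  with XD have "?X = D xs ys * ?Y * D ys xs" by simp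
  then have "similar_mat ?X ?Y"
    using DD[OF assms lx ly] DD[OF assms(2,1) assms(3)[symmetric] ly lx]
    by (intro similar_matI[of _ _ "D xs ys" "D ys xs" n]) (auto simp: D_def)
  from char_poly_similar[OF this] show ?thesis by (simp add: lx ly)
qed

lemma incidence_energy_eq:
  assumes "hypergraph V E" "E \<noteq> {}"
    and "distinct vs" "set vs = V" "distinct es" "set es = E"
  shows "incidence_energy V E = sum_mset (singular_values (incidence_mat vs es))"
proof -
  have fin: "finite V" "finite E"
    using assms(1) by (auto simp: hypergraph_def intro: finite_subset)
  note V = enumeration[OF fin(1)] and E = enumeration[OF fin(2)]
  show ?thesis
    using assms V E
      char_poly_mat_permute[of "enumeration V" vs "\<lambda>u v. real (card {e \<in> E. u \<in> e \<and> v \<in> e})"]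
    by (simp add: incidence_energy_def singular_values_def incidence_mat_mult_transpose)
qed

end

theory Submission
  imports Defs "Jordan_Normal_Form.Schur_Decomposition" "HOL-Analysis.Convex"
begin

text \<open>Let \<open>M = B B\<^sup>T\<close> have eigenvalues \<open>a\<^sub>i = x\<^sub>i\<^sup>2\<close>, so that \<open>\<Sum> a\<^sub>i = tr M = k m\<close>. The bounds are
  \<open>\<Sum> x\<^sub>i\<^sup>2 \<le> (\<Sum> x\<^sub>i)\<^sup>2 \<le> n \<Sum> x\<^sub>i\<^sup>2\<close>. Equality on the left means that at most one \<open>a\<^sub>i\<close> is nonzero,
  equality on the right that all \<open>a\<^sub>i\<close> agree; both are detected by \<open>\<Sum> a\<^sub>i\<^sup>2 = tr M\<^sup>2\<close>. The former
  amounts to \<open>tr M\<^sup>2 = (tr M)\<^sup>2\<close>, and since \<open>tr M\<^sup>2\<close> is the sum of \<open>\<bar>e \<inter> f\<bar>\<^sup>2\<close> over all pairs of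
  edges, this forces all edges to coincide. The latter would give \<open>n tr M\<^sup>2 = (tr M)\<^sup>2\<close>, which is
  impossible because \<open>M\<close> has a positive entry off the diagonal as soon as there is an edge.\<close>

section \<open>Traces, similarity and eigenvalues\<close>

definition mat_trace :: "'a :: comm_monoid_add mat \<Rightarrow> 'a" where
  "mat_trace A = (\<Sum>i<dim_row A. A $$ (i, i))"

lemma mat_trace_mult:
  assumes "A \<in> carrier_mat n m" "B \<in> carrier_mat m n"
  shows "mat_trace (A * B) = (\<Sum>i<n. \<Sum>j<m. A $$ (i, j) * B $$ (j, i))"
  using assms by (auto simp: mat_trace_def scalar_prod_def atLeast0LessThan intro!: sum.cong)

lemma mat_trace_comm:
  fixes A B :: "'a :: comm_semiring_0 mat"
  assumes "A \<in> carrier_mat n m" "B \<in> carrier_mat m n"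
  shows "mat_trace (A * B) = mat_trace (B * A)"
  unfolding mat_trace_mult[OF assms] mat_trace_mult[OF assms(2,1)]
  by (subst sum.swap) (simp add: mult.commute)

text \<open>Cyclicity of the trace brings \<open>Q\<close> and \<open>P\<close> together, where they
  cancel.\<close>

lemma mat_trace_similar:
  fixes A B :: "'a :: comm_ring_1 mat"
  assumes "similar_mat A B"
  shows "mat_trace A = mat_trace B"
proof -
  from similar_matD[OF assms] obtain n P Q where
    c: "{A, B, P, Q} \<subseteq> carrier_mat n n" and QP: "Q * P = 1\<^sub>m n" and A: "A = P * B * Q" by blast
  have "mat_trace A = mat_trace (Q * (P * B))"
    unfolding A using c by (intro mat_trace_comm[of _ n n]) auto
  also have "Q * (P * B) = B"
    using c QP by (subst assoc_mult_mat[symmetric, of _ n n _ n _ n]) auto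
  finally show ?thesis .
qed

text \<open>For i different from j, one of the entries (i, j) and (j, i) lies below the diagonal, so
  their product vanishes.\<close>

lemma mat_trace_square_upper_triangular:
  fixes B :: "'a :: comm_ring_1 mat"
  assumes B: "B \<in> carrier_mat n n" and "upper_triangular B"
  shows "mat_trace (B * B) = (\<Sum>i<n. (B $$ (i, i))\<^sup>2)"
  unfolding mat_trace_mult[OF B B]
proof (rule sum.cong[OF refl])
  fix i assume i: "i \<in> {..<n}"
  have "B $$ (i, j) * B $$ (j, i) = 0" if "j < n" "j \<noteq> i" for j
    using upper_triangularD[OF assms(2), of i j] upper_triangularD[OF assms(2), of j i] B i that
    by (cases i j rule: linorder_cases) auto
  then have "(\<Sum>j<n. B $$ (i, j) * B $$ (j, i)) = (\<Sum>j\<in>{i}. B $$ (i, j) * B $$ (j, i))"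
    using i by (intro sum.mono_neutral_right) auto
  then show "(\<Sum>j<n. B $$ (i, j) * B $$ (j, i)) = (B $$ (i, i))\<^sup>2"
    by (simp add: power2_eq_square)
qed

text \<open>Schur decomposition yields a similar upper triangular matrix whose diagonal is exactly
  \<open>as\<close>. The same \<open>P\<close> and \<open>Q\<close> relate the squares, so both
  traces can be read off that diagonal.\<close>

lemma mat_trace_eigenvalues:
  fixes A :: "real mat"
  assumes A: "A \<in> carrier_mat n n" and cp: "char_poly A = (\<Prod>a\<leftarrow>as. [:- a, 1:])"
  shows "mat_trace A = sum_list as"
    and "mat_trace (A * A) = (\<Sum>a\<leftarrow>as. a\<^sup>2)"
proof -
  obtain B P Q where "schur_decomposition A as = (B, P, Q)"
    by (cases "schur_decomposition A as") auto
  from schur_decomposition[OF A cp this]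
  have wit: "similar_mat_wit A B P Q" and ut: "upper_triangular B" and diag: "diag_mat B = as"
    by auto
  from similar_mat_witD2[OF A wit] have B: "B \<in> carrier_mat n n" by auto
  have as: "as = map (\<lambda>i. B $$ (i, i)) [0..<n]"
    using B diag by (auto simp: diag_mat_def)
  have sim: "similar_mat A B"
    using wit by (auto simp: similar_mat_def)
  have "similar_mat_wit (A ^\<^sub>m 2) (B ^\<^sub>m 2) P Q"
    by (rule similar_mat_wit_pow[OF wit])
  then have sim2: "similar_mat (A * A) (B * B)"
    using A B by (auto simp: similar_mat_def numeral_2_eq_2)
  show "mat_trace A = sum_list as"
    unfolding mat_trace_similar[OF sim] as using B
    by (simp add: mat_trace_def interv_sum_list_conv_sum_set_nat atLeast0LessThan)
  show "mat_trace (A * A) = (\<Sum>a\<leftarrow>as. a\<^sup>2)"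
    unfolding mat_trace_similar[OF sim2] mat_trace_square_upper_triangular[OF B ut] as
    by (simp add: o_def interv_sum_list_conv_sum_set_nat atLeast0LessThan)
qed

section \<open>Spectrum of a Gram matrix\<close>

text \<open>If \<open>A A\<^sup>T v = a v\<close>, then \<open>a \<bar>v\<bar>\<^sup>2 = \<bar>A\<^sup>T v\<bar>\<^sup>2\<close>, also for complex \<open>v\<close>.\<close>

lemma eigenvalue_gram_nonneg:
  fixes A :: "real mat"
  assumes A: "A \<in> carrier_mat n m"
    and ev: "eigenvalue (map_mat complex_of_real (A * transpose_mat A)) a"
  shows "\<exists>r\<ge>0. a = complex_of_real r"
proof -
  let ?M = "map_mat complex_of_real (A * transpose_mat A)"
  from ev obtain v where v: "v \<in> carrier_vec n" and nz: "v \<noteq> 0\<^sub>v n" and Mv: "?M *\<^sub>v v = a \<cdot>\<^sub>v v"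
    using A unfolding eigenvalue_def eigenvector_def by auto
  \<comment> \<open>\<open>w\<close> is the transpose of \<open>A\<close> applied to
    \<open>v\<close>; \<open>N\<close> and \<open>W\<close> are the squared norms of
    \<open>v\<close> and \<open>w\<close>, and the eigenvalue will be \<open>W / N\<close>.\<close>
  define w where "w l = (\<Sum>i<n. complex_of_real (A $$ (i, l)) * v $ i)" for l
  define N where "N = (\<Sum>i<n. (cmod (v $ i))\<^sup>2)"
  define W where "W = (\<Sum>l<m. (cmod (w l))\<^sup>2)"
  from nz v obtain i where "i < n" "v $ i \<noteq> 0"
    by (metis carrier_vecD eq_vecI index_zero_vec)
  then have "0 < N"
    unfolding N_def by (intro sum_pos2[of _ i]) auto
  have "a * v $ i = (\<Sum>l<m. complex_of_real (A $$ (i, l)) * w l)" if i: "i < n" for i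
  proof -
    have "a * v $ i = (?M *\<^sub>v v) $ i"
      unfolding Mv using v i by simp
    also have "\<dots> = (\<Sum>j<n. (\<Sum>l<m. complex_of_real (A $$ (i, l)) * complex_of_real (A $$ (j, l))) * v $ j)"
      using i A v by (auto simp: scalar_prod_def atLeast0LessThan intro!: sum.cong)
    also have "\<dots> = (\<Sum>l<m. complex_of_real (A $$ (i, l)) * w l)"
      unfolding w_def sum_distrib_left sum_distrib_right
      by (subst sum.swap) (simp add: mult_ac)
    finally show ?thesis .
  qed
  then have "(\<Sum>i<n. cnj (v $ i) * (a * v $ i)) =
      (\<Sum>i<n. cnj (v $ i) * (\<Sum>l<m. complex_of_real (A $$ (i, l)) * w l))"
    by simp
  also have "\<dots> = (\<Sum>l<m. cnj (w l) * w l)"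
  proof -
    \<comment> \<open>Since \<open>A\<close> is real, conjugating \<open>w l\<close> conjugates only
      the entries of \<open>v\<close>.\<close>
    have "cnj (w l) * w l = (\<Sum>i<n. cnj (v $ i) * (complex_of_real (A $$ (i, l)) * w l))" for l
      by (subst (1) w_def) (simp add: sum_distrib_left mult_ac)
    then show ?thesis
      unfolding sum_distrib_left by (subst sum.swap) simp
  qed
  also have "\<dots> = complex_of_real W"
    unfolding W_def of_real_sum complex_norm_square by (simp add: mult.commute)
  also have "(\<Sum>i<n. cnj (v $ i) * (a * v $ i)) = a * complex_of_real N"
    unfolding N_def of_real_sum complex_norm_square by (simp add: sum_distrib_left mult_ac)
  finally have "a = complex_of_real (W / N)"
    using \<open>0 < N\<close> by (simp add: field_simps)
  moreover have "0 \<le> W / N"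
    using \<open>0 < N\<close> unfolding W_def by (simp add: sum_nonneg)
  ultimately show ?thesis by blast
qed

text \<open>The characteristic polynomial splits over the complex numbers, and its roots there are
  real and nonnegative. The factorization descends to the reals because the coefficient embedding is
  injective.\<close>

lemma char_poly_gram_splits:
  fixes A :: "real mat"
  assumes A: "A \<in> carrier_mat n m"
  obtains as where "char_poly (A * transpose_mat A) = (\<Prod>a\<leftarrow>as. [:- a, 1:])"
    "length as = n" "\<forall>a\<in>set as. 0 \<le> a"
proof -
  interpret cp: map_poly_inj_idom_hom complex_of_real ..
  let ?M = "A * transpose_mat A"
  let ?C = "map_mat complex_of_real ?M"
  have M: "?M \<in> carrier_mat n n" and C: "?C \<in> carrier_mat n n"
    using A by auto
  from char_poly_factorized[OF C] obtain cs where
    cs: "char_poly ?C = (\<Prod>a\<leftarrow>cs. [:- a, 1:])" and len: "length cs = n" by auto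
  have real: "\<exists>r\<ge>0. a = complex_of_real r" if "a \<in> set cs" for a
    using that eigenvalue_gram_nonneg[OF A] eigenvalue_root_char_poly[OF C, of a]
    unfolding cs by (auto simp: poly_prod_list prod_list_zero_iff image_iff intro!: bexI[of _ a])
  have cs_Re: "map complex_of_real (map Re cs) = cs"
    using real by (fastforce simp: o_def intro!: map_idI)
  have "map_poly complex_of_real (char_poly ?M) = char_poly ?C"
    by (rule of_real_hom.char_poly_hom[OF M, symmetric])
  also have "\<dots> = (\<Prod>a\<leftarrow>map complex_of_real (map Re cs). [:- a, 1:])"
    unfolding cs cs_Re ..
  also have "\<dots> = map_poly complex_of_real (\<Prod>a\<leftarrow>map Re cs. [:- a, 1:])"
    by (simp add: cp.hom_prod_list o_def)
  finally have "char_poly ?M = (\<Prod>a\<leftarrow>map Re cs. [:- a, 1:])"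
    by simp
  then show thesis
    using that[of "map Re cs"] len real by fastforce
qed

text \<open>Links the multiset in \<open>singular_values\<close> to a list of eigenvalues.\<close>

lemma proots_prod_linear_factors:
  fixes as :: "'a :: idom list"
  shows "proots (\<Prod>a\<leftarrow>as. [:- a, 1:]) = mset as"
proof (induction as)
  case (Cons a as)
  have "(\<Prod>a\<leftarrow>as. [:- a, 1:]) \<noteq> 0"
    by (auto simp: prod_list_zero_iff)
  then have "proots ([:- a, 1:] * (\<Prod>a\<leftarrow>as. [:- a, 1:])) = {#a#} + mset as"
    by (subst proots_mult) (auto simp: Cons.IH)
  then show ?case by (simp only: list.map prod_list.Cons mset.simps) simp
qed simp

section \<open>Power sum inequalities with equality cases\<close>

text \<open>Prepending \<open>x\<close> adds the cross term \<open>2 * (x * ?S)\<close>, which is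
  nonnegative and vanishes only if \<open>x\<close> or all later entries are zero. The equality case
  serves both the singular values and the eigenvalues.\<close>

lemma sum_list_nonneg_power2:
  fixes xs :: "real list"
  assumes "\<forall>x\<in>set xs. 0 \<le> x"
  shows "(\<Sum>x\<leftarrow>xs. x\<^sup>2) \<le> (sum_list xs)\<^sup>2"
    and "(\<Sum>x\<leftarrow>xs. x\<^sup>2) = (sum_list xs)\<^sup>2 \<longleftrightarrow> length (filter (\<lambda>x. x \<noteq> 0) xs) \<le> 1"
proof -
  have "(\<Sum>x\<leftarrow>xs. x\<^sup>2) \<le> (sum_list xs)\<^sup>2 \<and>
    ((\<Sum>x\<leftarrow>xs. x\<^sup>2) = (sum_list xs)\<^sup>2 \<longleftrightarrow> length (filter (\<lambda>x. x \<noteq> 0) xs) \<le> 1)"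
    using assms
  proof (induction xs)
    case (Cons x xs)
    let ?S = "sum_list xs"
    have x: "0 \<le> x" and xs: "\<forall>x\<in>set xs. 0 \<le> x" using Cons.prems by auto
    have S: "0 \<le> ?S" using xs by (intro sum_list_nonneg) auto
    have S0: "?S = 0 \<longleftrightarrow> filter (\<lambda>x. x \<noteq> 0) xs = []"
      using xs by (subst sum_list_nonneg_eq_0_iff) (auto simp: filter_empty_conv)
    have exp: "(x + ?S)\<^sup>2 = x\<^sup>2 + ?S\<^sup>2 + 2 * (x * ?S)"
      by (simp add: power2_eq_square algebra_simps)
    have p: "0 \<le> x * ?S" using x S by simp
    note IH = Cons.IH[OF xs]
    have eq: "(\<Sum>y\<leftarrow>x # xs. y\<^sup>2) = (sum_list (x # xs))\<^sup>2 \<longleftrightarrow>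
        (\<Sum>y\<leftarrow>xs. y\<^sup>2) = ?S\<^sup>2 \<and> x * ?S = 0"
      using IH p by (auto simp: exp)
    show ?case
    proof
      show "(\<Sum>y\<leftarrow>x # xs. y\<^sup>2) \<le> (sum_list (x # xs))\<^sup>2"
        using IH p by (simp add: exp)
      show "(\<Sum>y\<leftarrow>x # xs. y\<^sup>2) = (sum_list (x # xs))\<^sup>2 \<longleftrightarrow>
          length (filter (\<lambda>x. x \<noteq> 0) (x # xs)) \<le> 1"
        unfolding eq using IH S0 by (cases "x = 0") auto
    qed
  qed simp
  then show "(\<Sum>x\<leftarrow>xs. x\<^sup>2) \<le> (sum_list xs)\<^sup>2"
    and "(\<Sum>x\<leftarrow>xs. x\<^sup>2) = (sum_list xs)\<^sup>2 \<longleftrightarrow> length (filter (\<lambda>x. x \<noteq> 0) xs) \<le> 1"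
    by auto
qed

text \<open>The gap between the two sides, times the length, is the sum of the squares of
  \<open>?n * x - ?S\<close>, the scaled deviations from the mean.\<close>

lemma sum_list_power2_le:
  fixes xs :: "real list"
  shows "(sum_list xs)\<^sup>2 \<le> real (length xs) * (\<Sum>x\<leftarrow>xs. x\<^sup>2)"
    and "(sum_list xs)\<^sup>2 = real (length xs) * (\<Sum>x\<leftarrow>xs. x\<^sup>2) \<Longrightarrow> \<exists>c. \<forall>x\<in>set xs. x = c"
proof -
  let ?n = "real (length xs)" and ?S = "sum_list xs"
  have "(\<Sum>x\<leftarrow>xs. (a * x - b)\<^sup>2) =
      a\<^sup>2 * (\<Sum>x\<leftarrow>xs. x\<^sup>2) - 2 * a * b * sum_list xs + real (length xs) * b\<^sup>2" for a b
    by (induction xs) (auto simp: power2_eq_square algebra_simps)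
  from this[of ?n ?S] have var:
    "(\<Sum>x\<leftarrow>xs. (?n * x - ?S)\<^sup>2) = ?n * (?n * (\<Sum>x\<leftarrow>xs. x\<^sup>2) - ?S\<^sup>2)"
    by (simp add: power2_eq_square algebra_simps)
  have nonneg: "0 \<le> (\<Sum>x\<leftarrow>xs. (?n * x - ?S)\<^sup>2)"
    by (intro sum_list_nonneg) auto
  show "?S\<^sup>2 \<le> ?n * (\<Sum>x\<leftarrow>xs. x\<^sup>2)"
  proof (cases "xs = []")
    case False
    then show ?thesis using nonneg unfolding var by (simp add: zero_le_mult_iff)
  qed simp
  assume "?S\<^sup>2 = ?n * (\<Sum>x\<leftarrow>xs. x\<^sup>2)"
  then have "(\<Sum>x\<leftarrow>xs. (?n * x - ?S)\<^sup>2) = 0" unfolding var by simp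
  then have "\<forall>x\<in>set xs. ?n * x = ?S"
    by (subst (asm) sum_list_nonneg_eq_0_iff) auto
  \<comment> \<open>Any member \<open>x\<close> witnesses that \<open>xs\<close> is nonempty, so the
    division is legitimate.\<close>
  then have "\<forall>x\<in>set xs. x = ?S / ?n"
    by (metis empty_iff length_0_conv list.set(1) nonzero_mult_div_cancel_left of_nat_eq_0_iff)
  then show "\<exists>c. \<forall>x\<in>set xs. x = c" by blast
qed

section \<open>Counting vertices and edges\<close>

text \<open>Both sides count the quadruples (u, v, e, f) in which the edges e and f each contain u
  and v.\<close>

lemma sum_codegree_squares:
  assumes "finite V" "finite E" "E \<subseteq> Pow V"
  shows "(\<Sum>u\<in>V. \<Sum>v\<in>V. (card {e \<in> E. u \<in> e \<and> v \<in> e})\<^sup>2) = (\<Sum>e\<in>E. \<Sum>f\<in>E. (card (e \<inter> f))\<^sup>2)"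
proof -
  let ?b = "\<lambda>v e. of_bool (v \<in> e) :: nat"
  have deg: "card {e \<in> E. u \<in> e \<and> v \<in> e} = (\<Sum>e\<in>E. ?b u e * ?b v e)" for u v
    using assms(2) by (simp add: of_bool_conj[symmetric] Int_def)
  have int: "card (e \<inter> f) = (\<Sum>v\<in>V. ?b v e * ?b v f)" if "e \<in> E" for e f
  proof -
    have "V \<inter> {v. v \<in> e \<and> v \<in> f} = e \<inter> f" using that assms(3) by auto
    then show ?thesis
      using assms(1) by (simp add: of_bool_conj[symmetric])
  qed
  have "(\<Sum>u\<in>V. \<Sum>v\<in>V. (card {e \<in> E. u \<in> e \<and> v \<in> e})\<^sup>2) =
      (\<Sum>(u, v)\<in>V \<times> V. \<Sum>(e, f)\<in>E \<times> E. ?b u e * ?b v e * (?b u f * ?b v f))"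
    by (simp add: deg power2_eq_square sum_product sum.cartesian_product[symmetric])
  \<comment> \<open>For fixed \<open>e\<close> and \<open>f\<close> the inner sum is now a product
    of two equal sums, each counting \<open>e \<inter> f\<close>.\<close>
  also have "\<dots> = (\<Sum>(e, f)\<in>E \<times> E. \<Sum>(u, v)\<in>V \<times> V. ?b u e * ?b u f * (?b v e * ?b v f))"
    unfolding case_prod_unfold by (subst sum.swap) (simp add: mult_ac)
  also have "\<dots> = (\<Sum>e\<in>E. \<Sum>f\<in>E. (card (e \<inter> f))\<^sup>2)"
    by (simp add: int power2_eq_square sum_product sum.cartesian_product[symmetric])
  finally show ?thesis .
qed

lemma sum_degrees:
  assumes "finite V" "finite E" "E \<subseteq> Pow V"
  shows "(\<Sum>v\<in>V. card {e \<in> E. v \<in> e}) = (\<Sum>e\<in>E. card e)"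
proof -
  have "{v \<in> V. v \<in> e} = e" if "e \<in> E" for e using that assms by auto
  then show ?thesis
    using sum_multicount_gen[of V E "\<lambda>v e. v \<in> e" "\<lambda>e. card e"] assms by simp
qed

text \<open>The entries of \<open>M\<close> are codegrees, with the degrees on the diagonal. As
  \<open>M\<close> is symmetric, the trace of its square is the sum of its squared entries.\<close>

lemma incidence_gram_traces:
  assumes "distinct vs" "set vs = V" "distinct es" "set es = E"
  defines "M \<equiv> incidence_mat vs es * transpose_mat (incidence_mat vs es)"
  shows "mat_trace M = real (\<Sum>v\<in>V. card {e \<in> E. v \<in> e})"
    and "mat_trace (M * M) = real (\<Sum>u\<in>V. \<Sum>v\<in>V. (card {e \<in> E. u \<in> e \<and> v \<in> e})\<^sup>2)"
proof -
  let ?n = "length vs"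
  define d where "d u v = real (card {e \<in> E. u \<in> e \<and> v \<in> e})" for u v
  have M: "M = mat ?n ?n (\<lambda>(i, j). d (vs ! i) (vs ! j))"
    unfolding M_def d_def incidence_mat_mult_transpose[OF assms(3)] assms(4) ..
  have reindex: "(\<Sum>i<?n. g (vs ! i)) = sum g V" for g :: "'a \<Rightarrow> real"
    using sum.reindex_bij_betw[OF bij_betw_nth[OF assms(1) refl refl], of g] assms(2) by simp
  have "mat_trace M = (\<Sum>i<?n. d (vs ! i) (vs ! i))"
    by (simp add: mat_trace_def M)
  also have "\<dots> = (\<Sum>v\<in>V. d v v)" by (rule reindex)
  finally show "mat_trace M = real (\<Sum>v\<in>V. card {e \<in> E. v \<in> e})"
    by (simp add: d_def)
  have "M \<in> carrier_mat ?n ?n" by (simp add: M)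
  then have "mat_trace (M * M) = (\<Sum>i<?n. \<Sum>j<?n. (d (vs ! i) (vs ! j))\<^sup>2)"
    by (subst mat_trace_mult) (auto simp: M d_def power2_eq_square conj_commute intro!: sum.cong)
  also have "\<dots> = (\<Sum>u\<in>V. \<Sum>v\<in>V. (d u v)\<^sup>2)"
    by (simp add: reindex[of "\<lambda>v. (d _ v)\<^sup>2"] reindex[of "\<lambda>u. \<Sum>v\<in>V. (d u v)\<^sup>2"])
  finally show "mat_trace (M * M) = real (\<Sum>u\<in>V. \<Sum>v\<in>V. (card {e \<in> E. u \<in> e \<and> v \<in> e})\<^sup>2)"
    by (simp add: d_def)
qed

text \<open>The right side is the sum of the square of \<open>k\<close> over all pairs of edges and
  dominates the left side term by term. Equality therefore makes every intersection as large as both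
  edges.\<close>

lemma sum_intersection_squares_eq_iff:
  assumes "finite E" "\<forall>e\<in>E. card e = k" "0 < k"
  shows "(\<Sum>e\<in>E. \<Sum>f\<in>E. (card (e \<inter> f))\<^sup>2) = (k * card E)\<^sup>2 \<longleftrightarrow> card E \<le> 1"
proof
  \<comment> \<open>Infinite sets have \<open>card\<close> 0, which \<open>0 < k\<close>
    excludes.\<close>
  have fin: "finite e" if "e \<in> E" for e
    using that assms(2,3) by (metis card.infinite less_irrefl)
  have le: "(card (e \<inter> f))\<^sup>2 \<le> k\<^sup>2" if "e \<in> E" for e f
    using card_mono[OF fin[OF that], of "e \<inter> f"] that assms(2) by (auto intro: power_mono)
  assume eq: "(\<Sum>e\<in>E. \<Sum>f\<in>E. (card (e \<inter> f))\<^sup>2) = (k * card E)\<^sup>2"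
  have "e = f" if ef: "e \<in> E" "f \<in> E" for e f
  proof -
    have "(\<Sum>(e, f)\<in>E \<times> E. (card (e \<inter> f))\<^sup>2) = (\<Sum>(e, f)\<in>E \<times> E. k\<^sup>2)"
      using eq by (simp add: sum.cartesian_product[symmetric] card_cartesian_product power2_eq_square
          algebra_simps)
    then have "(card (e \<inter> f))\<^sup>2 = k\<^sup>2"
      using sum_mono_inv[of "\<lambda>(e, f). (card (e \<inter> f))\<^sup>2" "E \<times> E" "\<lambda>(e, f). k\<^sup>2" "(e, f)"]
        le ef assms(1) by auto
    then have "card (e \<inter> f) = card e" "card (e \<inter> f) = card f"
      using ef assms(2) by auto
    then have "e \<inter> f = e" "e \<inter> f = f"
      using ef fin by (meson card_subset_eq inf_le1 inf_le2)+
    then show ?thesis by simp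
  qed
  then show "card E \<le> 1"
    by (auto simp: card_le_Suc0_iff_eq[OF assms(1)])
next
  assume "card E \<le> 1"
  then consider "E = {}" | e where "E = {e}"
    using assms(1) by (metis card_0_eq card_1_singletonE le_antisym less_one not_le)
  then show "(\<Sum>e\<in>E. \<Sum>f\<in>E. (card (e \<inter> f))\<^sup>2) = (k * card E)\<^sup>2"
    using assms(2) by cases auto
qed

text \<open>An edge has two distinct vertices, so some codegree off the diagonal is positive.\<close>

lemma sum_codegree_squares_gt:
  assumes "finite V" "finite E" "E \<subseteq> Pow V" "e \<in> E" "2 \<le> card e"
  shows "(\<Sum>v\<in>V. card {e \<in> E. v \<in> e})\<^sup>2 <
    card V * (\<Sum>u\<in>V. \<Sum>v\<in>V. (card {e \<in> E. u \<in> e \<and> v \<in> e})\<^sup>2)"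
proof -
  let ?d = "\<lambda>u v. card {e \<in> E. u \<in> e \<and> v \<in> e}"
  have "\<not> card e \<le> 1" using assms(5) by simp
  moreover have "finite e" using assms(5) by (metis card.infinite not_numeral_le_zero)
  ultimately obtain x y where xy: "x \<in> e" "y \<in> e" "x \<noteq> y"
    by (auto simp: card_le_Suc0_iff_eq)
  have V: "x \<in> V" "y \<in> V" using xy assms by auto
  have "0 < ?d x y" using assms xy by (auto simp: card_gt_0_iff)
  then have "(?d x x)\<^sup>2 < (\<Sum>v\<in>{x, y}. (?d x v)\<^sup>2)" using xy by simp
  also have "\<dots> \<le> (\<Sum>v\<in>V. (?d x v)\<^sup>2)"
    using V assms(1) by (intro sum_mono2) auto
  finally have strict: "(?d x x)\<^sup>2 < (\<Sum>v\<in>V. (?d x v)\<^sup>2)" .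
  have "(?d u u)\<^sup>2 \<le> (\<Sum>v\<in>V. (?d u v)\<^sup>2)" if "u \<in> V" for u
    using that assms(1) by (intro member_le_sum[of u V "\<lambda>v. (?d u v)\<^sup>2"]) auto
  \<comment> \<open>The inequality is strict in row \<open>x\<close> and weak in every other
    row.\<close>
  with strict have "(\<Sum>u\<in>V. (?d u u)\<^sup>2) < (\<Sum>u\<in>V. \<Sum>v\<in>V. (?d u v)\<^sup>2)"
    using V assms(1) by (intro sum_strict_mono_ex1) blast+
  moreover have "0 < card V" using V assms(1) by (auto simp: card_gt_0_iff)
  \<comment> \<open>Cauchy-Schwarz against the constant 1 handles the diagonal; strictness comes
    from the off-diagonal entries alone.\<close>
  moreover have "(\<Sum>u\<in>V. ?d u u)\<^sup>2 \<le> card V * (\<Sum>u\<in>V. (?d u u)\<^sup>2)"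
  proof -
    have "(\<Sum>u\<in>V. real (?d u u))\<^sup>2 \<le> (\<Sum>u\<in>V. (real (?d u u))\<^sup>2) * (\<Sum>u\<in>V. 1\<^sup>2)"
      using Cauchy_Schwarz_ineq_sum[of "\<lambda>u. real (?d u u)" "\<lambda>_. 1" V] by simp
    then have "real ((\<Sum>u\<in>V. ?d u u)\<^sup>2) \<le> real (card V * (\<Sum>u\<in>V. (?d u u)\<^sup>2))"
      by (simp add: mult.commute)
    then show ?thesis by (simp only: of_nat_le_iff)
  qed
  ultimately show ?thesis
    by (simp add: le_less_trans)
qed

section \<open>Energy bounds and their equality cases\<close>

theorem theorem13:
  fixes V :: "'a set" and E :: "'a set set" and k n m :: nat
  assumes "uniform_hypergraph k V E"
    and "card V = n" and "card E = m"
  shows "sqrt (real (k * m)) \<le> incidence_energy V E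
    \<and> incidence_energy V E \<le> sqrt (real (k * m * n))
    \<and> (sqrt (real (k * m)) = incidence_energy V E \<longleftrightarrow> card E \<le> 1)
    \<and> (incidence_energy V E = sqrt (real (k * m * n)) \<longleftrightarrow> E = {})"
proof (cases "E = {}")
  case True
  \<comment> \<open>Here \<open>m\<close> is 0, so both bounds and the energy vanish.\<close>
  then show ?thesis using assms(3) by (auto simp: incidence_energy_def)
next
  case False
  have V: "finite V" and EV: "E \<subseteq> Pow V" and k: "2 \<le> k" and unif: "\<forall>e\<in>E. card e = k"
    using assms(1) by (auto simp: uniform_hypergraph_def hypergraph_def)
  have E: "finite E" using V EV by (meson finite_Pow_iff finite_subset)
  define B where "B = incidence_mat (enumeration V) (enumeration E)"
  let ?M = "B * transpose_mat B"
  have len: "length (enumeration V) = n"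
    using enumeration[OF V] assms(2) by (metis distinct_card)
  have B: "B \<in> carrier_mat n (length (enumeration E))"
    by (simp add: B_def incidence_mat_def len)
  from char_poly_gram_splits[OF B] obtain as where
    cp: "char_poly ?M = (\<Prod>a\<leftarrow>as. [:- a, 1:])" and las: "length as = n"
    and as: "\<forall>a\<in>set as. 0 \<le> a" .
  define S4 where "S4 = (\<Sum>u\<in>V. \<Sum>v\<in>V. (card {e \<in> E. u \<in> e \<and> v \<in> e})\<^sup>2)"
  have M: "?M \<in> carrier_mat n n" using B by auto
  note traces = incidence_gram_traces[OF enumeration[OF V] enumeration[OF E], folded B_def S4_def]
  have deg: "(\<Sum>v\<in>V. card {e \<in> E. v \<in> e}) = k * m"
    using sum_degrees[OF V E EV] unif assms(3) by simp
  define xs where "xs = map sqrt as"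
  have xs: "\<forall>x\<in>set xs. 0 \<le> x" and lxs: "length xs = n"
    using as las by (auto simp: xs_def)
  have as_xs: "as = map (\<lambda>x. x\<^sup>2) xs"
    using as by (auto simp: xs_def map_idI)
  have S1: "incidence_energy V E = sum_list xs"
  proof -
    have "proots (char_poly ?M) = mset as"
      unfolding cp by (rule proots_prod_linear_factors)
    then show ?thesis
      using False by (simp add: incidence_energy_def singular_values_def B_def[symmetric] xs_def
        flip: sum_mset_sum_list)
  qed
  have S2: "(\<Sum>x\<leftarrow>xs. x\<^sup>2) = real (k * m)"
    using mat_trace_eigenvalues(1)[OF M cp] traces(1) unfolding deg as_xs by simp
  have S4: "(\<Sum>a\<leftarrow>as. a\<^sup>2) = real S4"
    using mat_trace_eigenvalues(2)[OF M cp] traces(2) by simp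
  have sum_as: "sum_list as = real (k * m)"
    using S2 as_xs by simp
  have nonneg: "0 \<le> sum_list xs" using xs by (intro sum_list_nonneg) auto
  have lower: "sqrt (real (k * m)) \<le> sum_list xs"
    using sum_list_nonneg_power2(1)[OF xs] nonneg unfolding S2 by (rule real_le_lsqrt[rotated])
  have upper: "sum_list xs \<le> sqrt (real (k * m * n))"
    using sum_list_power2_le(1)[of xs] unfolding S2 lxs
    by (intro real_le_rsqrt) (simp add: mult_ac)
  have "sqrt (real (k * m)) = sum_list xs \<longleftrightarrow> (\<Sum>x\<leftarrow>xs. x\<^sup>2) = (sum_list xs)\<^sup>2"
    unfolding S2 using nonneg by (metis of_nat_0_le_iff real_sqrt_pow2 real_sqrt_unique)
  \<comment> \<open>Squaring preserves being nonzero, so the count passes from singular values to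
    eigenvalues. The same equality criterion, applied to \<open>as\<close>, then turns it into a
    statement about traces.\<close>
  also have "\<dots> \<longleftrightarrow> length (filter (\<lambda>a. a \<noteq> 0) as) \<le> 1"
    unfolding sum_list_nonneg_power2(2)[OF xs] as_xs by (simp add: filter_map o_def)
  also have "\<dots> \<longleftrightarrow> S4 = (k * m)\<^sup>2"
    unfolding sum_list_nonneg_power2(2)[OF as, symmetric] S4 sum_as
    by (metis of_nat_eq_iff of_nat_power)
  also have "\<dots> \<longleftrightarrow> card E \<le> 1"
    unfolding S4_def sum_codegree_squares[OF V E EV] assms(3)[symmetric]
    using k by (intro sum_intersection_squares_eq_iff[OF E unif]) auto
  finally have lower_eq: "sqrt (real (k * m)) = sum_list xs \<longleftrightarrow> card E \<le> 1" .
  \<comment> \<open>As \<open>E\<close> is nonempty in this case, the equivalence for the upper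
    bound reduces to strictness.\<close>
  have upper_neq: "sum_list xs \<noteq> sqrt (real (k * m * n))"
  proof
    assume "sum_list xs = sqrt (real (k * m * n))"
    then have "(sum_list xs)\<^sup>2 = real (length xs) * (\<Sum>x\<leftarrow>xs. x\<^sup>2)"
      unfolding S2 lxs by (simp add: mult_ac)
    then obtain c where "\<forall>x\<in>set xs. x = c"
      using sum_list_power2_le(2) by blast
    \<comment> \<open>Equal singular values have equal squares, so equality also holds for the
      eigenvalues, where the power sums are the integers \<open>k * m\<close> and
      \<open>S4\<close>.\<close>
    then have "as = replicate n (c\<^sup>2)"
      using lxs unfolding as_xs by (intro replicate_eqI) auto
    then have "(sum_list as)\<^sup>2 = real n * (\<Sum>a\<leftarrow>as. a\<^sup>2)"
      by (simp add: sum_list_replicate power2_eq_square)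
    then have "real ((k * m)\<^sup>2) = real (n * S4)"
      unfolding S4 sum_as by simp
    then have "(k * m)\<^sup>2 = n * S4"
      by (simp only: of_nat_eq_iff)
    moreover obtain e where "e \<in> E" using False by auto
    ultimately show False
      using sum_codegree_squares_gt[OF V E EV, of e] k unif
      unfolding deg S4_def[symmetric] assms(2) by auto
  qed
  show ?thesis
    unfolding S1 using lower upper lower_eq upper_neq False by blast
qed

end
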